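(* Let $X_0,\dots,X_{n-1}$ be observations from a strictly stationary real-valued process. For any $\omega\in\mathcal{F}_n:=\{2\pi j/n: j=1,\dots,\lfloor\frac{n-1}2\rfloor\}$, $$I_{n,\rho}(\omega)=12\int_{[0,1]^2}I^{u,v}_{n,R}(\omega)\,du\,dv.$$ Moreover, for any fixed $\omega\in\mathbb{R}$, $$\hat G_{n,\rho}(\omega)=12\int_{[0,1]^2}\hat G_{n,R}(u,v;\omega)\,du\,dv.$$
   Context: Notation. $I\{\cdot\}$ is the indicator function; $\hat F_n(x):=n^{-1}\sum_{t=0}^{n-1}I\{X_t\le x\}$ is the empirical distribution function and $R_{n;t}=n\hat F_n(X_t)$ is the rank of $X_t$ among $X_0,\dots,X_{n-1}$. The Spearman coefficient at lag $k$ and the Spearman periodogram are $$\hat\rho_n^k:=\frac{12}{n^3}\sum_{t=0}^{n-|k|-1}\Big(R_{n;t}-\frac{n+1}2\Big)\Big(R_{n;t+|k|}-\frac{n+1}2\Big),\qquad I_{n,\rho}(\omega):=\frac1{2\pi}\sum_{|k|<n}e^{-i\omega k}\hat\rho_n^k,$$ and the rank-based copula periodogram is $$I^{\tau_1,\tau_2}_{n,R}(\omega):=\frac1{2\pi n}d^{\tau_1}_{n,R}(\omega)d^{\tau_2}_{n,R}(-\omega),\qquad d^\tau_{n,R}(\omega):=\sum_{t=0}^{n-1}I\{\hat F_n(X_t)\le\tau\}e^{-i\omega t}=\sum_{t=0}^{n-1}I\{R_{n;t}\le n\tau\}e^{-i\omega t}.$$ The smoothed versions are $$\hat G_{n,\rho}(\omega):=\frac{2\pi}n\sum_{s=1}^{n-1}W_n(\omega-2\pi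 s/n)I_{n,\rho}(2\pi s/n),\qquad\hat G_{n,R}(\tau_1,\tau_2;\omega):=\frac{2\pi}n\sum_{s=1}^{n-1}W_n(\omega-2\pi s/n)I^{\tau_1,\tau_2}_{n,R}(2\pi s/n),$$ where $W_n$ is the sequence of weighting functions $W_n(u):=\sum_{j=-\infty}^\infty b_n^{-1}W(b_n^{-1}[u+2\pi j])$, with scaling parameters $b_n>0$, $b_n\to0$, $nb_n\to\infty$, and $W$ a real-valued even function of bounded variation with support $[-\pi,\pi]$ and $\int_{-\pi}^{\pi}W(u)\,du=1$. *)

theory Defs
  imports "HOL-Probability.Probability"
begin

section \<open>Strictly stationary processes\<close>

text \<open>
  The time index is \<^typ>\<open>nat\<close>: only the observations at times \<open>0, \<dots>, n - 1\<close> matter, and the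
  restriction to nonnegative times of a strictly stationary process indexed by the integers is
  strictly stationary in this sense.
\<close>

definition strictly_stationary :: "'a measure \<Rightarrow> (nat \<Rightarrow> 'a \<Rightarrow> real) \<Rightarrow> bool" where
  "strictly_stationary M X \<longleftrightarrow>
     (\<forall>t. X t \<in> borel_measurable M) \<and>
     (\<forall>J h. finite J \<longrightarrow>
        distr M (\<Pi>\<^sub>M t\<in>J. borel) (\<lambda>z. \<lambda>t\<in>J. X (t + h) z) =
        distr M (\<Pi>\<^sub>M t\<in>J. borel) (\<lambda>z. \<lambda>t\<in>J. X t z))"


section \<open>Rank-based statistics\<close>

text \<open>
  The statistics are functions of the sample size \<open>n\<close> and of a realized path \<open>x\<close>, of which
  only \<open>x 0, \<dots>, x (n - 1)\<close> are used.
\<close>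

definition ecdf :: "nat \<Rightarrow> (nat \<Rightarrow> real) \<Rightarrow> real \<Rightarrow> real" where
  "ecdf n x y = (1 / real n) * (\<Sum>t<n. of_bool (x t \<le> y))"

definition obs_rank :: "nat \<Rightarrow> (nat \<Rightarrow> real) \<Rightarrow> nat \<Rightarrow> real" where
  "obs_rank n x t = real n * ecdf n x (x t)"

definition spearman :: "nat \<Rightarrow> (nat \<Rightarrow> real) \<Rightarrow> int \<Rightarrow> real" where
  "spearman n x k =
     12 / real n ^ 3 *
       (\<Sum>t<n - nat \<bar>k\<bar>.
          (obs_rank n x t - (real n + 1) / 2) * (obs_rank n x (t + nat \<bar>k\<bar>) - (real n + 1) / 2))"

definition spearman_periodogram :: "nat \<Rightarrow> (nat \<Rightarrow> real) \<Rightarrow> real \<Rightarrow> complex" where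
  "spearman_periodogram n x \<omega> =
     1 / (2 * of_real pi) *
       (\<Sum>k | \<bar>k\<bar> < int n. exp (- (\<i> * of_real \<omega> * of_int k)) * of_real (spearman n x k))"

definition rank_dft :: "nat \<Rightarrow> (nat \<Rightarrow> real) \<Rightarrow> real \<Rightarrow> real \<Rightarrow> complex" where
  "rank_dft n x \<tau> \<omega> =
     (\<Sum>t<n. of_bool (ecdf n x (x t) \<le> \<tau>) * exp (- (\<i> * of_real \<omega> * of_nat t)))"

definition copula_periodogram ::
    "nat \<Rightarrow> (nat \<Rightarrow> real) \<Rightarrow> real \<Rightarrow> real \<Rightarrow> real \<Rightarrow> complex" where
  "copula_periodogram n x \<tau>\<^sub>1 \<tau>\<^sub>2 \<omega> =
     1 / (2 * of_real pi * of_nat n) * rank_dft n x \<tau>\<^sub>1 \<omega> * rank_dft n x \<tau>\<^sub>2 (- \<omega>)"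

definition fourier_frequencies :: "nat \<Rightarrow> real set" where
  "fourier_frequencies n = {2 * pi * real j / real n | j. j \<in> {1..(n - 1) div 2}}"


section \<open>Smoothing\<close>

definition bounded_variation :: "(real \<Rightarrow> real) \<Rightarrow> bool" where
  "bounded_variation f \<longleftrightarrow>
     (\<exists>V. \<forall>N p. mono p \<longrightarrow> (\<Sum>i<N. \<bar>f (p (Suc i)) - f (p i)\<bar>) \<le> V)"

text \<open>
  ``Support \<open>[-\<pi>, \<pi>]\<close>'' is read as ``supported in \<open>[-\<pi>, \<pi>]\<close>'', so that functions
  whose support is smaller than the full interval are admitted as well.
\<close>

definition weight_function :: "(real \<Rightarrow> real) \<Rightarrow> bool" where
  "weight_function W \<longleftrightarrow>
     (\<forall>u. W (- u) = W u) \<and>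
     bounded_variation W \<and>
     closure {u. W u \<noteq> 0} \<subseteq> {- pi..pi} \<and>
     (LINT u:{- pi..pi}|lborel. W u) = 1"

definition scaling_parameters :: "(nat \<Rightarrow> real) \<Rightarrow> bool" where
  "scaling_parameters b \<longleftrightarrow>
     (\<forall>n\<ge>1. b n > 0) \<and> b \<longlonglongrightarrow> 0 \<and> filterlim (\<lambda>n. real n * b n) at_top sequentially"

text \<open>
  For a weight function \<open>W\<close> and \<open>b n > 0\<close> only finitely many terms of the sum are nonzero.
\<close>

definition scaled_weight :: "(real \<Rightarrow> real) \<Rightarrow> (nat \<Rightarrow> real) \<Rightarrow> nat \<Rightarrow> real \<Rightarrow> real" where
  "scaled_weight W b n u =
     (\<Sum>\<^sub>\<infinity>j::int. inverse (b n) * W (inverse (b n) * (u + 2 * pi * of_int j)))"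

definition smoothed_spearman ::
    "(real \<Rightarrow> real) \<Rightarrow> (nat \<Rightarrow> real) \<Rightarrow> nat \<Rightarrow> (nat \<Rightarrow> real) \<Rightarrow> real \<Rightarrow> complex" where
  "smoothed_spearman W b n x \<omega> =
     2 * of_real pi / of_nat n *
       (\<Sum>s = 1..n - 1.
          of_real (scaled_weight W b n (\<omega> - 2 * pi * real s / real n)) *
          spearman_periodogram n x (2 * pi * real s / real n))"

definition smoothed_copula ::
    "(real \<Rightarrow> real) \<Rightarrow> (nat \<Rightarrow> real) \<Rightarrow> nat \<Rightarrow> (nat \<Rightarrow> real) \<Rightarrow> real \<Rightarrow> real \<Rightarrow> real \<Rightarrow> complex" where
  "smoothed_copula W b n x \<tau>\<^sub>1 \<tau>\<^sub>2 \<omega> =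
     2 * of_real pi / of_nat n *
       (\<Sum>s = 1..n - 1.
          of_real (scaled_weight W b n (\<omega> - 2 * pi * real s / real n)) *
          copula_periodogram n x \<tau>\<^sub>1 \<tau>\<^sub>2 (2 * pi * real s / real n))"

end

theory Submission
  imports Defs
begin

text \<open>
  Integrating the indicator \<open>I{R_t \<le> n u}\<close> over \<open>u \<in> [0, 1]\<close> gives \<open>1 - R_t / n\<close>, so the
  integrated copula periodogram is a product of two discrete Fourier transforms of
  \<open>1 - R_t / n\<close>. At a frequency \<open>2 \<pi> s / n\<close> with \<open>0 < s < n\<close> these transforms annihilate constants,
  so \<open>1 - R_t / n\<close> may be replaced by \<open>- (R_t - (n + 1) / 2) / n\<close>. The product of the
  transforms of a sequence at \<open>\<omega>\<close> and \<open>- \<omega>\<close> is the transform of its sample autocovariances,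
  which is the Spearman periodogram.
\<close>

text \<open>Pairs are sorted by diagonals: \<open>k\<close> is \<open>i - j\<close> and
  \<open>t\<close> is the smaller entry. Since \<open>f\<close> need not be symmetric, the sign of
  \<open>k\<close> decides which argument is the larger one.\<close>

lemma sum_lags_eq_sum_pairs:
  fixes f :: "nat \<Rightarrow> nat \<Rightarrow> 'a::comm_monoid_add"
  shows "(\<Sum>k | \<bar>k\<bar> < int n. \<Sum>t<n - nat \<bar>k\<bar>.
            if k \<ge> 0 then f (t + nat \<bar>k\<bar>) t else f t (t + nat \<bar>k\<bar>)) =
         (\<Sum>i<n. \<Sum>j<n. f i j)"
proof -
  have "{k. \<bar>k\<bar> < int n} = {- int n<..<int n}" by auto
  then have fin: "finite {k. \<bar>k\<bar> < int n}" by simp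
  have "(\<Sum>k | \<bar>k\<bar> < int n. \<Sum>t<n - nat \<bar>k\<bar>.
            if k \<ge> 0 then f (t + nat \<bar>k\<bar>) t else f t (t + nat \<bar>k\<bar>)) =
      (\<Sum>(k, t)\<in>(SIGMA k:{k. \<bar>k\<bar> < int n}. {..<n - nat \<bar>k\<bar>}).
            if k \<ge> 0 then f (t + nat \<bar>k\<bar>) t else f t (t + nat \<bar>k\<bar>))"
    by (rule sum.Sigma) (simp_all add: fin)
  also have "\<dots> = (\<Sum>(i, j)\<in>{..<n} \<times> {..<n}. f i j)"
    by (rule sum.reindex_bij_witness[where
          j = "\<lambda>(k, t). if k \<ge> 0 then (t + nat \<bar>k\<bar>, t) else (t, t + nat \<bar>k\<bar>)" and
          i = "\<lambda>(i, j). (int i - int j, min i j)"])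
       (auto split: if_splits)
  finally show ?thesis
    by (simp only: sum.cartesian_product)
qed

text \<open>A finite-sample Wiener-Khinchin identity: in the expanded product the phase depends only
  on the lag \<open>i - j\<close>, and collecting equal lags produces the autocovariances of
  \<open>a\<close>.\<close>

lemma autocovariance_transform:
  fixes a :: "nat \<Rightarrow> real"
  shows "(\<Sum>k | \<bar>k\<bar> < int n. exp (- (\<i> * of_real \<omega> * of_int k)) *
            of_real (\<Sum>t<n - nat \<bar>k\<bar>. a t * a (t + nat \<bar>k\<bar>))) =
         (\<Sum>t<n. of_real (a t) * exp (- (\<i> * of_real \<omega> * of_nat t))) *
         (\<Sum>t<n. of_real (a t) * exp (- (\<i> * of_real (- \<omega>) * of_nat t)))"
proof -
  \<comment> \<open>The difference of indices is formed in the complex numbers, so negative lags are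
    not truncated.\<close>
  define f where "f i j = of_real (a i * a j) *
    exp (- (\<i> * of_real \<omega> * (of_nat i - of_nat j)))" for i j
  have "exp (- (\<i> * of_real \<omega> * of_int k)) * of_real (a t * a (t + nat \<bar>k\<bar>)) =
      (if k \<ge> 0 then f (t + nat \<bar>k\<bar>) t else f t (t + nat \<bar>k\<bar>))" for k t
    by (auto simp: f_def algebra_simps)
  then have "(\<Sum>k | \<bar>k\<bar> < int n. exp (- (\<i> * of_real \<omega> * of_int k)) *
      of_real (\<Sum>t<n - nat \<bar>k\<bar>. a t * a (t + nat \<bar>k\<bar>))) = (\<Sum>i<n. \<Sum>j<n. f i j)"
    by (simp add: sum_distrib_left flip: sum_lags_eq_sum_pairs del: of_real_mult)
  also have "f i j = (of_real (a i) * exp (- (\<i> * of_real \<omega> * of_nat i))) *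
      (of_real (a j) * exp (- (\<i> * of_real (- \<omega>) * of_nat j)))" for i j
    by (simp add: f_def algebra_simps flip: exp_add)
  then have "(\<Sum>i<n. \<Sum>j<n. f i j) =
      (\<Sum>t<n. of_real (a t) * exp (- (\<i> * of_real \<omega> * of_nat t))) *
      (\<Sum>t<n. of_real (a t) * exp (- (\<i> * of_real (- \<omega>) * of_nat t)))"
    by (simp only: sum_product)
  finally show ?thesis .
qed

text \<open>This is the geometric sum of an \<open>n\<close>-th root of unity other than 1. Both
  signs of the frequency occur because a periodogram multiplies the transforms at
  \<open>\<omega>\<close> and \<open>- \<omega>\<close>.\<close>

lemma exp_sum_nonzero_frequency:
  assumes "0 < s" "s < n" and "\<omega> = 2 * pi * real s / real n \<or> \<omega> = - (2 * pi * real s / real n)"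
  shows "(\<Sum>t<n. exp (- (\<i> * of_real \<omega> * of_nat t))) = (0 :: complex)"
proof -
  define z :: complex where "z = exp (- (\<i> * of_real \<omega>))"
  have n: "n > 0" using assms by simp
  have pow: "exp (- (\<i> * of_real \<omega> * of_nat t)) = z ^ t" for t
    by (simp add: z_def mult.commute flip: exp_of_nat_mult)
  have "z ^ n = 1"
  proof -
    have "\<exists>m::int. \<omega> * real n = 2 * pi * of_int m"
      using assms(3)
    proof
      assume "\<omega> = 2 * pi * real s / real n"
      then show ?thesis using n by (intro exI[of _ "int s"]) simp
    next
      assume "\<omega> = - (2 * pi * real s / real n)"
      then show ?thesis using n by (intro exI[of _ "- int s"]) simp
    qed
    then obtain m :: int where m: "\<omega> * real n = 2 * pi * of_int m" by blast
    have "z ^ n = exp (- (\<i> * of_real (\<omega> * real n)))"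
      by (simp add: mult.assoc flip: pow)
    also have "\<dots> = 1"
      \<comment> \<open>The witness is \<open>- m\<close> because the exponent carries a minus
        sign.\<close>
      unfolding m exp_eq_1 by (auto intro!: exI[of _ "- m"])
    finally show ?thesis .
  qed
  moreover have "z \<noteq> 1"
  proof
    assume "z = 1"
    then obtain m :: int where m: "- \<omega> = of_int (2 * m) * pi"
      by (auto simp: z_def exp_eq_1)
    \<comment> \<open>Both expressions for \<open>\<omega> * real n\<close> are brought to the form
      \<open>pi * (2 * _)\<close>. Cancelling \<open>pi\<close> leaves an integer relation by which
      \<open>n\<close> divides \<open>s\<close>, impossible for \<open>0 < s < n\<close>.\<close>
    have "\<omega> * real n = pi * (2 * - (real n * of_int m))"
      using m by (simp add: minus_equation_iff[of \<omega>] eq_commute[of _ \<omega>])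
    moreover have "\<omega> * real n = pi * (2 * real s) \<or> \<omega> * real n = pi * (2 * - real s)"
      using assms(3) n by auto
    ultimately have "pi * (2 * - (real n * of_int m)) = pi * (2 * real s) \<or>
        pi * (2 * - (real n * of_int m)) = pi * (2 * - real s)"
      by metis
    then have "real s = real n * of_int m \<or> real s = - (real n * of_int m)"
      unfolding mult_left_cancel[OF pi_neq_zero] by linarith
    then have "int s = int n * m \<or> int s = - (int n * m)"
      by (metis (mono_tags) of_int_eq_iff of_int_minus of_int_mult of_int_of_nat_eq)
    then have "int n dvd int s"
      by (metis dvd_triv_left dvd_minus_iff)
    then show False
      using assms by (auto dest: nat_dvd_not_less)
  qed
  ultimately show ?thesis
    by (simp add: pow sum_gp_strict)
qed

lemma ecdf_nonneg: "0 \<le> ecdf n x y"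
  by (simp add: ecdf_def sum_nonneg)

lemma ecdf_le_1: "ecdf n x y \<le> 1"
proof -
  have "(\<Sum>t<n. of_bool (x t \<le> y)) \<le> (\<Sum>t<n. 1 :: real)"
    by (intro sum_mono) auto
  then show ?thesis
    \<comment> \<open>For \<open>n = 0\<close> the sum is empty and the value is 0.\<close>
    by (cases "n = 0") (auto simp: ecdf_def field_simps)
qed

text \<open>Inside the unit square the two indicators cut out the rectangle
  \<open>{a..1} \<times> {b..1}\<close>. The bounds on \<open>a\<close> and \<open>b\<close> keep it
  within the square and make its side lengths nonnegative.\<close>

lemma has_bochner_integral_upper_rectangle:
  fixes a b :: real
  assumes "0 \<le> a" "a \<le> 1" "0 \<le> b" "b \<le> 1"
  shows "has_bochner_integral lborel
    (\<lambda>p. indicator ({0..1} \<times> {0..1}) p *\<^sub>R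
       (of_bool (a \<le> fst p) * of_bool (b \<le> snd p) :: complex)) (of_real ((1 - a) * (1 - b)))"
proof -
  have "emeasure lborel ({a..1} \<times> {b..1}) = ennreal ((1 - a) * (1 - b))"
    using assms
    by (simp add: lborel.emeasure_pair_measure_Times ennreal_mult flip: lborel_prod)
  then have "has_bochner_integral lborel (indicator ({a..1} \<times> {b..1}) :: real \<times> real \<Rightarrow> real)
      ((1 - a) * (1 - b))"
    using assms has_bochner_integral_real_indicator[of "{a..1} \<times> {b..1}" lborel]
    by (auto simp: measure_def closed_Times borel_closed)
  then have "has_bochner_integral lborel
      (\<lambda>p. of_real (indicator ({a..1} \<times> {b..1}) p) :: complex) (of_real ((1 - a) * (1 - b)))"
    by (rule has_bochner_integral_of_real)
  also have "(\<lambda>p. of_real (indicator ({a..1} \<times> {b..1}) p)) =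
      (\<lambda>p. indicator ({0..1} \<times> {0..1}) p *\<^sub>R
       (of_bool (a \<le> fst p) * of_bool (b \<le> snd p) :: complex))"
    using assms by (auto simp: fun_eq_iff indicator_def split: if_splits)
  finally show ?thesis .
qed

text \<open>As a function of \<open>(u, v)\<close> the periodogram is a finite linear combination of
  rectangle indicators. Each area is a product of side lengths, so the integrated double sum factors
  again, at any frequency.\<close>

lemma has_bochner_integral_copula_periodogram:
  "has_bochner_integral lborel
     (\<lambda>p. indicator ({0..1} \<times> {0..1}) p *\<^sub>R
        (case p of (u, v) \<Rightarrow> copula_periodogram n x u v \<omega>))
     (1 / (2 * of_real pi * of_nat n) *
       ((\<Sum>t<n. of_real (1 - ecdf n x (x t)) * exp (- (\<i> * of_real \<omega> * of_nat t))) *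
        (\<Sum>t<n. of_real (1 - ecdf n x (x t)) * exp (- (\<i> * of_real (- \<omega>) * of_nat t)))))"
proof -
  define F where "F t = ecdf n x (x t)" for t
  define e where "e \<theta> t = exp (- (\<i> * of_real \<theta> * of_nat t))" for \<theta> t
  define c :: complex where "c = 1 / (2 * of_real pi * of_nat n)"
  have rect: "has_bochner_integral lborel
      (\<lambda>p. indicator ({0..1} \<times> {0..1}) p *\<^sub>R
         (of_bool (F s \<le> fst p) * of_bool (F t \<le> snd p) :: complex))
      (of_real ((1 - F s) * (1 - F t)))" for s t
    by (intro has_bochner_integral_upper_rectangle) (simp_all add: F_def ecdf_nonneg ecdf_le_1)
  have "has_bochner_integral lborel
      (\<lambda>p. \<Sum>s<n. \<Sum>t<n. (c * e \<omega> s * e (- \<omega>) t) *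
         (indicator ({0..1} \<times> {0..1}) p *\<^sub>R
           (of_bool (F s \<le> fst p) * of_bool (F t \<le> snd p))))
      (\<Sum>s<n. \<Sum>t<n. (c * e \<omega> s * e (- \<omega>) t) * of_real ((1 - F s) * (1 - F t)))"
    by (intro has_bochner_integral_sum has_bochner_integral_mult_right rect)
  also have "(\<lambda>p. \<Sum>s<n. \<Sum>t<n. (c * e \<omega> s * e (- \<omega>) t) *
         (indicator ({0..1} \<times> {0..1}) p *\<^sub>R
           (of_bool (F s \<le> fst p) * of_bool (F t \<le> snd p)))) =
      (\<lambda>p. indicator ({0..1} \<times> {0..1}) p *\<^sub>R
        (case p of (u, v) \<Rightarrow> copula_periodogram n x u v \<omega>))"
  proof (intro ext, clarify)
    fix u v :: real
    let ?I = "indicator ({0..1} \<times> {0..1}) (u, v) :: real"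
    have "?I *\<^sub>R copula_periodogram n x u v \<omega> = of_real ?I * (c *
        ((\<Sum>s<n. of_bool (F s \<le> u) * e \<omega> s) * (\<Sum>t<n. of_bool (F t \<le> v) * e (- \<omega>) t)))"
      by (simp only: copula_periodogram_def rank_dft_def F_def e_def c_def mult.assoc
          scaleR_conv_of_real)
    also have "\<dots> = (\<Sum>s<n. \<Sum>t<n. (c * e \<omega> s * e (- \<omega>) t) *
         (?I *\<^sub>R (of_bool (F s \<le> fst (u, v)) * of_bool (F t \<le> snd (u, v)))))"
      unfolding sum_product
      unfolding sum_distrib_left scaleR_conv_of_real fst_conv snd_conv
      by (simp only: mult_ac)
    finally show "(\<Sum>s<n. \<Sum>t<n. (c * e \<omega> s * e (- \<omega>) t) *
         (?I *\<^sub>R (of_bool (F s \<le> fst (u, v)) * of_bool (F t \<le> snd (u, v))))) =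
       ?I *\<^sub>R copula_periodogram n x u v \<omega>" ..
  qed
  also have "(\<Sum>s<n. \<Sum>t<n. (c * e \<omega> s * e (- \<omega>) t) * of_real ((1 - F s) * (1 - F t))) =
      c * ((\<Sum>t<n. of_real (1 - F t) * e \<omega> t) * (\<Sum>t<n. of_real (1 - F t) * e (- \<omega>) t))"
    unfolding sum_product
    unfolding sum_distrib_left of_real_mult by (simp only: mult_ac)
  finally show ?thesis
    by (simp only: F_def e_def c_def)
qed

text \<open>Up to the factor \<open>12 / n ^ 3\<close>, the Spearman coefficients are the
  autocovariances of the centered ranks, so \<open>autocovariance_transform\<close> applies at every
  frequency.\<close>

lemma spearman_periodogram_eq_transforms:
  fixes x n
  defines "a \<equiv> \<lambda>t. obs_rank n x t - (real n + 1) / 2"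
  shows "spearman_periodogram n x \<omega> = 12 / (2 * of_real pi * of_nat n ^ 3) *
    ((\<Sum>t<n. of_real (a t) * exp (- (\<i> * of_real \<omega> * of_nat t))) *
     (\<Sum>t<n. of_real (a t) * exp (- (\<i> * of_real (- \<omega>) * of_nat t))))"
proof -
  have sp: "of_real (spearman n x k) = (12 / of_nat n ^ 3 :: complex) *
      of_real (\<Sum>t<n - nat \<bar>k\<bar>. a t * a (t + nat \<bar>k\<bar>))" for k
    unfolding spearman_def a_def of_real_mult by simp
  show ?thesis
    unfolding spearman_periodogram_def sp autocovariance_transform[symmetric]
    by (simp add: sum_distrib_left mult_ac del: of_real_sum)
qed

lemma centered_rank_transform:
  assumes "0 < s" "s < n" and "\<omega> = 2 * pi * real s / real n \<or> \<omega> = - (2 * pi * real s / real n)"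
  shows "(\<Sum>t<n. of_real (obs_rank n x t - (real n + 1) / 2) *
            exp (- (\<i> * of_real \<omega> * of_nat t))) =
    - of_nat n * (\<Sum>t<n. of_real (1 - ecdf n x (x t)) * exp (- (\<i> * of_real \<omega> * of_nat t)))"
proof -
  define e where "e t = exp (- (\<i> * of_real \<omega> * of_nat t))" for t
  have e0: "sum e {..<n} = 0"
    using exp_sum_nonzero_frequency[OF assms] by (simp add: e_def)
  \<comment> \<open>The constant is \<open>n - (n + 1) / 2 = (n - 1) / 2\<close>; its contribution
    vanishes by \<open>e0\<close>.\<close>
  have "of_real (obs_rank n x t - (real n + 1) / 2) * e t =
      - of_nat n * (of_real (1 - ecdf n x (x t)) * e t) + of_real ((real n - 1) / 2) * e t" for t
    by (simp add: obs_rank_def field_simps)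
  then have "(\<Sum>t<n. of_real (obs_rank n x t - (real n + 1) / 2) * e t) =
      - of_nat n * (\<Sum>t<n. of_real (1 - ecdf n x (x t)) * e t)
      + of_real ((real n - 1) / 2) * sum e {..<n}"
    by (simp only: sum.distrib sum_distrib_left)
  then show ?thesis
    by (simp add: e0 flip: e_def)
qed

text \<open>The two factors \<open>- n\<close> from centering multiply to \<open>n ^ 2\<close> and
  reduce \<open>1 / n ^ 3\<close> to the \<open>1 / n\<close> of the copula periodogram. The range
  \<open>0 < s < n\<close> covers the Fourier frequencies as well as all frequencies in the
  smoothing sums.\<close>

lemma has_bochner_integral_copula_periodogram_spearman:
  assumes "0 < s" "s < n"
  shows "has_bochner_integral lborel
    (\<lambda>p. indicator ({0..1} \<times> {0..1}) p *\<^sub>R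
       (case p of (u, v) \<Rightarrow> copula_periodogram n x u v (2 * pi * real s / real n)))
    (spearman_periodogram n x (2 * pi * real s / real n) / 12)"
proof -
  define \<omega> where "\<omega> = 2 * pi * real s / real n"
  have "spearman_periodogram n x \<omega> / 12 = 1 / (2 * of_real pi * of_nat n) *
       ((\<Sum>t<n. of_real (1 - ecdf n x (x t)) * exp (- (\<i> * of_real \<omega> * of_nat t))) *
        (\<Sum>t<n. of_real (1 - ecdf n x (x t)) * exp (- (\<i> * of_real (- \<omega>) * of_nat t))))"
    unfolding spearman_periodogram_eq_transforms
      centered_rank_transform[OF assms disjI1[OF \<omega>_def]]
      centered_rank_transform[OF assms disjI2[OF arg_cong[where f = uminus, OF \<omega>_def]]]
    using assms by (simp add: power3_eq_cube del: of_real_minus of_real_diff)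
  then show ?thesis
    using has_bochner_integral_copula_periodogram[of n x \<omega>] by (simp only: \<omega>_def)
qed

text \<open>Smoothing is linear in the periodograms and samples them only at
  \<open>2 * pi * s / n\<close> with \<open>0 < s < n\<close>. Since \<open>\<omega>\<close> enters
  only through weights that are constant in \<open>(u, v)\<close>, it may be any real
  number.\<close>

lemma has_bochner_integral_smoothed_copula:
  "has_bochner_integral lborel
    (\<lambda>p. indicator ({0..1} \<times> {0..1}) p *\<^sub>R
       (case p of (u, v) \<Rightarrow> smoothed_copula W b n x u v \<omega>))
    (smoothed_spearman W b n x \<omega> / 12)"
proof -
  define w :: "nat \<Rightarrow> complex" where
    "w s = of_real (scaled_weight W b n (\<omega> - 2 * pi * real s / real n))" for s
  have "has_bochner_integral lborel
    (\<lambda>p. 2 * of_real pi / of_nat n * (\<Sum>s = 1..n - 1. w s *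
       (indicator ({0..1} \<times> {0..1}) p *\<^sub>R
         (case p of (u, v) \<Rightarrow> copula_periodogram n x u v (2 * pi * real s / real n)))))
    (2 * of_real pi / of_nat n * (\<Sum>s = 1..n - 1. w s *
       (spearman_periodogram n x (2 * pi * real s / real n) / 12)))"
    by (intro has_bochner_integral_sum has_bochner_integral_mult_right
        has_bochner_integral_copula_periodogram_spearman) auto
  also have "(\<lambda>p. 2 * of_real pi / of_nat n * (\<Sum>s = 1..n - 1. w s *
       (indicator ({0..1} \<times> {0..1}) p *\<^sub>R
         (case p of (u, v) \<Rightarrow> copula_periodogram n x u v (2 * pi * real s / real n))))) =
    (\<lambda>p. indicator ({0..1} \<times> {0..1}) p *\<^sub>R
       (case p of (u, v) \<Rightarrow> smoothed_copula W b n x u v \<omega>))"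
    by (auto simp: fun_eq_iff smoothed_copula_def w_def indicator_def)
  also have "2 * of_real pi / of_nat n * (\<Sum>s = 1..n - 1. w s *
       (spearman_periodogram n x (2 * pi * real s / real n) / 12)) =
    smoothed_spearman W b n x \<omega> / 12"
    by (simp add: smoothed_spearman_def w_def flip: sum_divide_distrib)
  finally show ?thesis .
qed

theorem proposition4p1:
  fixes M :: "'a measure" and X :: "nat \<Rightarrow> 'a \<Rightarrow> real" and n :: nat
    and W :: "real \<Rightarrow> real" and b :: "nat \<Rightarrow> real"
  assumes "prob_space M" and "strictly_stationary M X" and "n \<ge> 1"
    and "weight_function W" and "scaling_parameters b"
  shows "\<forall>z\<in>space M.
    (\<forall>\<omega>\<in>fourier_frequencies n.
       set_integrable lborel ({0..1} \<times> {0..1})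
         (\<lambda>(u, v). copula_periodogram n (\<lambda>t. X t z) u v \<omega>) \<and>
       spearman_periodogram n (\<lambda>t. X t z) \<omega> =
         12 * (LINT (u, v):{0..1} \<times> {0..1}|lborel. copula_periodogram n (\<lambda>t. X t z) u v \<omega>)) \<and>
    (\<forall>\<omega>.
       set_integrable lborel ({0..1} \<times> {0..1})
         (\<lambda>(u, v). smoothed_copula W b n (\<lambda>t. X t z) u v \<omega>) \<and>
       smoothed_spearman W b n (\<lambda>t. X t z) \<omega> =
         12 * (LINT (u, v):{0..1} \<times> {0..1}|lborel. smoothed_copula W b n (\<lambda>t. X t z) u v \<omega>))"
proof -
  have integral: "set_integrable lborel S f \<and> I = 12 * (LINT p:S|lborel. f p)"
    if "has_bochner_integral lborel (\<lambda>p. indicator S p *\<^sub>R f p) (I / 12)"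
    for f :: "real \<times> real \<Rightarrow> complex" and S I
    using that has_bochner_integral_integral_eq[OF that]
    by (auto simp: set_integrable_def set_lebesgue_integral_def has_bochner_integral_iff)
  have frequency: "\<exists>s. 0 < s \<and> s < n \<and> \<omega> = 2 * pi * real s / real n"
    if "\<omega> \<in> fourier_frequencies n" for \<omega>
  proof -
    from that obtain j where "j \<in> {1..(n - 1) div 2}" "\<omega> = 2 * pi * real j / real n"
      unfolding fourier_frequencies_def by blast
    \<comment> \<open>A \<open>j \<ge> 1\<close> with \<open>j \<le> (n - 1) div 2\<close> exists
      only for \<open>n \<ge> 3\<close>, and then \<open>j < n\<close>.\<close>
    then show ?thesis by (intro exI[of _ j]) auto
  qed
  have spearman: "set_integrable lborel ({0..1} \<times> {0..1})
         (\<lambda>(u, v). copula_periodogram n x u v \<omega>) \<and>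
       spearman_periodogram n x \<omega> =
         12 * (LINT (u, v):{0..1} \<times> {0..1}|lborel. copula_periodogram n x u v \<omega>)"
    if "\<omega> \<in> fourier_frequencies n" for x \<omega>
    using frequency[OF that] has_bochner_integral_copula_periodogram_spearman[THEN integral]
    by metis
  show ?thesis
    \<comment> \<open>The instance of \<open>conjI\<close> splits only the outer conjunction; the
      inner ones stay whole to match \<open>spearman\<close> and \<open>integral\<close>.\<close>
    by (intro ballI conjI[of "\<forall>\<omega>\<in>A. P \<omega>" for A P] allI spearman
        integral[OF has_bochner_integral_smoothed_copula])
qed

end
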